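(* Let $C$ be a nonempty closed convex subset of a real Hilbert space $H$. Let $\{f_i\}_{i=1}^N$ be a finite family of bifunctions on $C$ satisfying conditions A1--A4 (listed in the context), with A2 holding with common constants $c_1,c_2>0$, and let $\{S_j\}_{j=1}^M$ be a finite family of nonexpansive mappings $S_j:C\to C$. Suppose that the set $F=\left(\bigcap_{i=1}^N EP(f_i)\right)\cap\left(\bigcap_{j=1}^M F(S_j)\right)$ is nonempty. Let $x_0\in C$, $0<\rho<\min\left\{\frac{1}{2c_1},\frac{1}{2c_2}\right\}$, and let $\{\alpha_n\}_{n\ge 0}\subset(0,1)$ satisfy $\limsup_{n\to\infty}\alpha_n<1$. If the parallel hybrid Mann-extragradient method (described in the context) does not stop after finitely many iterations, then the infinite sequence $\{x_n\}$ it generates converges strongly to $x^\dagger=P_F x_0$.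
   Context: A bifunction on $C$ is a function $f:C\times C\to\mathbb{R}\cup\{+\infty\}$ with $f(x,x)=0$ for all $x\in C$. $EP(f)=\{x^*\in C: f(x^*,y)\ge 0\ \forall y\in C\}$. A mapping $S:C\to C$ is nonexpansive if $\|Sx-Sy\|\le\|x-y\|$ for all $x,y\in C$; $F(S)$ is its set of fixed points. $P_D$ denotes the metric projection onto a nonempty closed convex set $D$. Conditions on a bifunction $f$: A1. $f$ is pseudomonotone: for all $x,y\in C$, $f(x,y)\ge 0\Rightarrow f(y,x)\le 0$. A2. $f$ is Lipschitz-type continuous: there are constants $c_1,c_2>0$ such that $f(x,y)+f(y,z)\ge f(x,z)-c_1\|x-y\|^2-c_2\|y-z\|^2$ for all $x,y,z\in C$. (For a finite family, common constants $c_1,c_2$ are used, obtained by taking maxima.) A3. $f$ is weakly continuous on $C\times C$: if $x_n\rightharpoonup x$ and $y_n\rightharpoonup y$ in $C$, then $f(x_n,y_n)\to f(x,y)$. A4. $f(x,\cdot)$ is convex and subdifferentiable on $C$ for every fixed $x\in C$. Parallel hybrid Mann-extragradient method. Starting with $x_0\in C$, for $n=0,1,2,\dots$: 1. $y_n^i=\operatorname{argmin}\{\rho f_i(x_n,y)+\frac12\|x_n-y\|^2: y\in C\}$, $i=1,\dots,N$. 2. $z_n^i=\operatorname{argmin}\{\rho f_i(y_n^i,y)+\frac12\|x_n-y\|^2: y\in C\}$, $i=1,\dots,N$. 3. Choose $i_n\in\operatorname{argmax}\{\|z_n^i-x_n\|: i=1,\dots,N\}$ and set $\bar z_n:=z_n^{i_n}$.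 4. $u_n^j=\alpha_n x_n+(1-\alpha_n)S_j\bar z_n$, $j=1,\dots,M$. 5. Choose $j_n\in\operatorname{argmax}\{\|u_n^j-x_n\|: j=1,\dots,M\}$ and set $\bar u_n:=u_n^{j_n}$. 6. $C_n=\{v\in C:\|\bar u_n-v\|\le\|x_n-v\|\}$ and $Q_n=\{v\in C:\langle x_0-x_n,v-x_n\rangle\le 0\}$. 7. $x_{n+1}=P_{C_n\cap Q_n}(x_0)$. 8. If $x_{n+1}=x_n$, stop; otherwise continue with $n+1$. *)

theory Defs
  imports "HOL-Analysis.Analysis"
begin

text \<open>Bifunctions take values in \<open>\<real> \<union> {+\<infinity>}\<close>, rendered as \<^typ>\<open>ereal\<close> without \<open>-\<infinity>\<close>. Bifunctions
  and mappings are total functions; only their behaviour on \<open>C\<close> is constrained.\<close>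

definition bifunction_on :: "'a set \<Rightarrow> ('a \<Rightarrow> 'a \<Rightarrow> ereal) \<Rightarrow> bool" where
  "bifunction_on C f \<longleftrightarrow> (\<forall>x\<in>C. \<forall>y\<in>C. f x y \<noteq> -\<infinity>) \<and> (\<forall>x\<in>C. f x x = 0)"

definition EP :: "'a set \<Rightarrow> ('a \<Rightarrow> 'a \<Rightarrow> ereal) \<Rightarrow> 'a set" where
  "EP C f = {x \<in> C. \<forall>y\<in>C. f x y \<ge> 0}"

definition pseudomonotone_on :: "'a set \<Rightarrow> ('a \<Rightarrow> 'a \<Rightarrow> ereal) \<Rightarrow> bool" where
  "pseudomonotone_on C f \<longleftrightarrow> (\<forall>x\<in>C. \<forall>y\<in>C. f x y \<ge> 0 \<longrightarrow> f y x \<le> 0)"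

definition lipschitz_type_on ::
    "real \<Rightarrow> real \<Rightarrow> 'a::real_normed_vector set \<Rightarrow> ('a \<Rightarrow> 'a \<Rightarrow> ereal) \<Rightarrow> bool" where
  "lipschitz_type_on c1 c2 C f \<longleftrightarrow>
     (\<forall>x\<in>C. \<forall>y\<in>C. \<forall>z\<in>C.
        f x y + f y z \<ge> f x z - ereal (c1 * (norm (x - y))\<^sup>2) - ereal (c2 * (norm (y - z))\<^sup>2))"

text \<open>Weak convergence of sequences in a Hilbert space: functionals are given by the inner product.\<close>

definition weakly_converges :: "(nat \<Rightarrow> 'a::real_inner) \<Rightarrow> 'a \<Rightarrow> bool" where
  "weakly_converges X l \<longleftrightarrow> (\<forall>w. (\<lambda>n. X n \<bullet> w) \<longlonglongrightarrow> l \<bullet> w)"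

definition weakly_continuous_on :: "'a::real_inner set \<Rightarrow> ('a \<Rightarrow> 'a \<Rightarrow> ereal) \<Rightarrow> bool" where
  "weakly_continuous_on C f \<longleftrightarrow>
     (\<forall>X Y. \<forall>x\<in>C. \<forall>y\<in>C.
        (\<forall>n. X n \<in> C) \<and> (\<forall>n. Y n \<in> C) \<and> weakly_converges X x \<and> weakly_converges Y y
        \<longrightarrow> (\<lambda>n. f (X n) (Y n)) \<longlonglongrightarrow> f x y)"

text \<open>The library's \<open>convex_on\<close> is restricted to real-valued functions. At the endpoints, \<open>0 * \<infinity> = 0\<close>
  in \<^typ>\<open>ereal\<close> makes the inequality trivial.\<close>

definition ereal_convex_on :: "'a::real_vector set \<Rightarrow> ('a \<Rightarrow> ereal) \<Rightarrow> bool" where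
  "ereal_convex_on C g \<longleftrightarrow>
     (\<forall>y\<in>C. \<forall>z\<in>C. \<forall>t\<in>{0..1}.
        g ((1 - t) *\<^sub>R y + t *\<^sub>R z) \<le> ereal (1 - t) * g y + ereal t * g z)"

definition subdifferential_on :: "'a::real_inner set \<Rightarrow> ('a \<Rightarrow> ereal) \<Rightarrow> 'a \<Rightarrow> 'a set" where
  "subdifferential_on C g y = {w. \<forall>z\<in>C. g z \<ge> g y + ereal (w \<bullet> (z - y))}"

text \<open>A proper function has no subgradient where it is \<open>+\<infinity>\<close>, so subgradients are required on the
  effective domain only. If \<open>g\<close> is finite on \<open>C\<close>, this is every point of \<open>C\<close>.\<close>

definition subdifferentiable_on :: "'a::real_inner set \<Rightarrow> ('a \<Rightarrow> ereal) \<Rightarrow> bool" where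
  "subdifferentiable_on C g \<longleftrightarrow> (\<forall>y\<in>C. g y < \<infinity> \<longrightarrow> subdifferential_on C g y \<noteq> {})"

definition nonexpansive_on :: "'a::real_normed_vector set \<Rightarrow> ('a \<Rightarrow> 'a) \<Rightarrow> bool" where
  "nonexpansive_on C S \<longleftrightarrow> S ` C \<subseteq> C \<and> (\<forall>x\<in>C. \<forall>y\<in>C. norm (S x - S y) \<le> norm (x - y))"

definition fixed_points :: "'a set \<Rightarrow> ('a \<Rightarrow> 'a) \<Rightarrow> 'a set" where
  "fixed_points C S = {x \<in> C. S x = x}"

text \<open>The library's \<open>closest_point\<close> is restricted to Heine-Borel spaces, which excludes
  infinite-dimensional Hilbert spaces.\<close>

definition metric_proj :: "'a::real_normed_vector set \<Rightarrow> 'a \<Rightarrow> 'a" where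
  "metric_proj D x = arg_min_on (\<lambda>p. norm (x - p)) D"

definition prox_objective ::
    "real \<Rightarrow> ('a::real_normed_vector \<Rightarrow> ereal) \<Rightarrow> 'a \<Rightarrow> 'a \<Rightarrow> ereal" where
  "prox_objective \<rho> g x y = ereal \<rho> * g y + ereal ((norm (x - y))\<^sup>2 / 2)"

text \<open>\<open>mann_extragradient_step C N f M S \<rho> a x0 x x'\<close>: with parameter \<open>a\<close>, the current iterate \<open>x\<close>
  can be succeeded by \<open>x'\<close>. The relation accounts for the free choice of the maximal indices \<open>i0\<close>
  and \<open>j0\<close>.\<close>

definition mann_extragradient_step ::
    "'a::real_inner set \<Rightarrow> nat \<Rightarrow> (nat \<Rightarrow> 'a \<Rightarrow> 'a \<Rightarrow> ereal) \<Rightarrow> nat \<Rightarrow> (nat \<Rightarrow> 'a \<Rightarrow> 'a) \<Rightarrow>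
     real \<Rightarrow> real \<Rightarrow> 'a \<Rightarrow> 'a \<Rightarrow> 'a \<Rightarrow> bool" where
  "mann_extragradient_step C N f M S \<rho> a x0 x x' \<longleftrightarrow>
     (\<exists>y z i0 u j0.
        (\<forall>i\<in>{1..N}. is_arg_min (prox_objective \<rho> (f i x) x) (\<lambda>v. v \<in> C) (y i)) \<and>
        (\<forall>i\<in>{1..N}. is_arg_min (prox_objective \<rho> (f i (y i)) x) (\<lambda>v. v \<in> C) (z i)) \<and>
        is_arg_max (\<lambda>i. norm (z i - x)) (\<lambda>i. i \<in> {1..N}) i0 \<and>
        (\<forall>j\<in>{1..M}. u j = a *\<^sub>R x + (1 - a) *\<^sub>R S j (z i0)) \<and>
        is_arg_max (\<lambda>j. norm (u j - x)) (\<lambda>j. j \<in> {1..M}) j0 \<and>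
        x' = metric_proj
               ({v \<in> C. norm (u j0 - v) \<le> norm (x - v)} \<inter> {v \<in> C. (x0 - x) \<bullet> (v - x) \<le> 0}) x0)"

definition mann_extragradient_iterates ::
    "'a::real_inner set \<Rightarrow> nat \<Rightarrow> (nat \<Rightarrow> 'a \<Rightarrow> 'a \<Rightarrow> ereal) \<Rightarrow> nat \<Rightarrow> (nat \<Rightarrow> 'a \<Rightarrow> 'a) \<Rightarrow>
     real \<Rightarrow> (nat \<Rightarrow> real) \<Rightarrow> 'a \<Rightarrow> (nat \<Rightarrow> 'a) \<Rightarrow> bool" where
  "mann_extragradient_iterates C N f M S \<rho> \<alpha> x0 x \<longleftrightarrow>
     x 0 = x0 \<and> (\<forall>n. mann_extragradient_step C N f M S \<rho> (\<alpha> n) x0 (x n) (x (Suc n)))"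

end

(* Two proximal steps satisfy
     |z - w|^2 <= |x - w|^2 - (1 - 2 rho c1) |y - x|^2 - (1 - 2 rho c2) |z - y|^2   for w in EP(f),
   so F is contained in all the sets C_n and Q_n. Since x_n is the projection of x0 onto Q_n,
   |x_n - x0| is increasing and bounded, hence |x_{n+1} - x_n| -> 0, and the residuals |y_n^i - x_n|,
   |z_n^i - x_n|, |S_j x_n - x_n| follow. Every weak cluster point p therefore lies in F. For w in F
   the obtuse angle at x_n gives |x_n - x0|^2 + |w - x_n|^2 <= |w - x0|^2; with w = p it turns weak
   into strong convergence along the subsequence and shows lim |x_n - x0| = |p - x0| = dist(x0, F);
   with w = P_F x0 it then gives convergence of the whole sequence. *)
theory Submission
  imports Defs "HOL-Library.Diagonal_Subsequence"
begin

section \<open>Metric projection in a Hilbert space\<close>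

text \<open>The residuals have to be obtained in a particular order. Membership of
  \<open>x (Suc n)\<close> in C_n controls only u_n^j - x_n; since 1 - \<alpha>_n stays away from 0,
  this transfers to S_j zbar_n - x_n. The link back to the proximal steps is that S_j fixes each w
  in F, so |S_j zbar_n - w| <= |zbar_n - w| <= |x_n - w|. The outer two differ by a null sequence,
  hence the gap |x_n - w|^2 - |zbar_n - w|^2, which dominates the proximal residuals, vanishes as
  well. The maximal choices of i_n and j_n let one selected index speak for its whole family.
  Bifunction values may be infinite, so finiteness has to be secured before the proximal
  inequalities can be written in the reals; f(u,u) = 0 supplies a finite competitor. The space may
  be nonseparable, so weak compactness starts by testing a bounded sequence against its own terms
  only.\<close>

lemma le_if_le_add_mult_small:
  fixes a b K :: real
  assumes "\<And>t. 0 < t \<Longrightarrow> t < 1 \<Longrightarrow> a \<le> b + t * K"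
  shows "a \<le> b"
proof (rule tendsto_lowerbound)
  show "((\<lambda>t. b + t * K) \<longlongrightarrow> b) (at_right 0)"
    using tendsto_add[OF tendsto_const[of b] tendsto_mult[OF tendsto_ident_at tendsto_const[of K]], of 0]
    by simp
  show "eventually (\<lambda>t. a \<le> b + t * K) (at_right 0)"
    by (rule eventually_mono[OF eventually_at_right_real[OF zero_less_one]]) (auto intro: assms)
qed simp

lemma norm_diff_scaleR_sq:
  fixes u w :: "'a::real_inner"
  shows "(norm (u - t *\<^sub>R w))\<^sup>2 = (norm u)\<^sup>2 - 2 * t * (u \<bullet> w) + t\<^sup>2 * (norm w)\<^sup>2"
  unfolding power2_norm_eq_inner
  by (simp add: inner_diff_left inner_diff_right inner_commute[of w u] power2_eq_square
      algebra_simps)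

text \<open>A minimizing sequence is Cauchy by the parallelogram law, because the midpoint of two of
  its terms stays in \<open>D\<close> and so has squared distance at least \<open>d\<close> from
  \<open>a\<close>.\<close>

lemma convex_closed_closest_point:
  fixes D :: "'a::{real_inner, complete_space} set"
  assumes D: "D \<noteq> {}" "closed D" "convex D"
  obtains p where "is_arg_min (\<lambda>p. norm (a - p)) (\<lambda>p. p \<in> D) p"
proof -
  define d where "d = Inf ((\<lambda>p. (norm (a - p))\<^sup>2) ` D)"
  have bdd: "bdd_below ((\<lambda>p. (norm (a - p))\<^sup>2) ` D)"
    by (rule bdd_belowI[of _ 0]) auto
  have d_le: "d \<le> (norm (a - p))\<^sup>2" if "p \<in> D" for p
    unfolding d_def using that bdd by (intro cInf_lower) auto
  have "\<exists>p\<in>D. (norm (a - p))\<^sup>2 < d + 1 / real (Suc n)" for n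
    using cInf_lessD[of "(\<lambda>p. (norm (a - p))\<^sup>2) ` D" "d + 1 / real (Suc n)"] D(1)
    by (auto simp: d_def)
  then obtain X where X: "\<And>n. X n \<in> D" "\<And>n. (norm (a - X n))\<^sup>2 < d + 1 / real (Suc n)"
    by metis
  have dist: "(norm (X m - X n))\<^sup>2 \<le> 2 / real (Suc m) + 2 / real (Suc n)" for m n
  proof -
    have "(1/2) *\<^sub>R X m + (1/2) *\<^sub>R X n \<in> D"
      using D(3) X(1) by (auto simp: convex_def)
    from d_le[OF this] have "d \<le> (norm (a - ((1/2) *\<^sub>R X m + (1/2) *\<^sub>R X n)))\<^sup>2" .
    moreover have "4 * (norm (a - ((1/2) *\<^sub>R X m + (1/2) *\<^sub>R X n)))\<^sup>2 + (norm (X m - X n))\<^sup>2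
        = 2 * (norm (a - X m))\<^sup>2 + 2 * (norm (a - X n))\<^sup>2"
      by (simp add: power2_norm_eq_inner inner_simps inner_commute algebra_simps)
    ultimately show ?thesis
      using X(2)[of m] X(2)[of n] by simp
  qed
  have "Cauchy X"
  proof (rule metric_CauchyI)
    fix e :: real
    assume e: "e > 0"
    \<comment> \<open>From index \<open>K\<close> on, each of the two terms in \<open>dist\<close>
      is at most 2 / (K + 1), together below e^2.\<close>
    obtain K where K: "4 / e\<^sup>2 < real (Suc K)"
      using reals_Archimedean2 by (metis lessI less_trans of_nat_less_iff)
    have "dist (X m) (X n) < e" if "m \<ge> K" "n \<ge> K" for m n
    proof -
      have "2 / real (Suc m) \<le> 2 / real (Suc K)" "2 / real (Suc n) \<le> 2 / real (Suc K)"
        using that by (auto intro!: divide_left_mono)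
      moreover have "4 / real (Suc K) < e\<^sup>2"
        using K e by (simp add: field_simps)
      ultimately have "(norm (X m - X n))\<^sup>2 < e\<^sup>2"
        using dist[of m n] by simp
      then show ?thesis
        using e by (simp add: dist_norm power_less_imp_less_base)
    qed
    then show "\<exists>K. \<forall>m\<ge>K. \<forall>n\<ge>K. dist (X m) (X n) < e"
      by blast
  qed
  then obtain p where p: "X \<longlonglongrightarrow> p"
    using Cauchy_convergent convergent_def by blast
  have "p \<in> D"
    using closed_sequentially[OF D(2) _ p] X(1) by blast
  have "(norm (a - p))\<^sup>2 \<le> d"
  proof (rule LIMSEQ_le)
    show "(\<lambda>n. (norm (a - X n))\<^sup>2) \<longlonglongrightarrow> (norm (a - p))\<^sup>2"
      by (intro tendsto_intros p)
    show "(\<lambda>n. d + 1 / real (Suc n)) \<longlonglongrightarrow> d"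
      using tendsto_add[OF tendsto_const[of d] LIMSEQ_inverse_real_of_nat]
      by (simp add: inverse_eq_divide)
    show "\<exists>N. \<forall>n\<ge>N. (norm (a - X n))\<^sup>2 \<le> d + 1 / real (Suc n)"
      using X(2) less_imp_le by blast
  qed
  then have "norm (a - p) \<le> norm (a - q)" if "q \<in> D" for q
    by (rule power2_le_imp_le[OF order_trans[OF _ d_le[OF that]]]) simp_all
  with \<open>p \<in> D\<close> show thesis
    using that[of p] by (simp add: is_arg_min_linorder)
qed

text \<open>\<open>arg_min_on\<close> is a Hilbert choice: one known minimizer is what guarantees
  that the chosen point is a minimizer too.\<close>

lemma metric_proj_is_arg_min:
  assumes "is_arg_min (\<lambda>p. norm (a - p)) (\<lambda>p. p \<in> D) p"
  shows "is_arg_min (\<lambda>p. norm (a - p)) (\<lambda>p. p \<in> D) (metric_proj D a)"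
  unfolding metric_proj_def arg_min_on_def arg_min_def
  by (rule someI[of "is_arg_min (\<lambda>p. norm (a - p)) (\<lambda>p. p \<in> D)", OF assms])

text \<open>The obtuse angle is first-order optimality: compare the projection with points at
  parameter \<open>t\<close> on the segment towards \<open>v\<close>, divide by \<open>t\<close>,
  let \<open>t\<close> tend to 0.\<close>

lemma metric_proj_closed_convex:
  fixes D :: "'a::{real_inner, complete_space} set"
  assumes D: "D \<noteq> {}" "closed D" "convex D"
  shows metric_proj_in: "metric_proj D a \<in> D"
    and metric_proj_obtuse: "v \<in> D \<Longrightarrow> (a - metric_proj D a) \<bullet> (v - metric_proj D a) \<le> 0"
proof -
  define p where "p = metric_proj D a"
  obtain q where "is_arg_min (\<lambda>p. norm (a - p)) (\<lambda>p. p \<in> D) q"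
    using convex_closed_closest_point[OF D] .
  from metric_proj_is_arg_min[OF this]
  have p: "p \<in> D" and min: "\<And>q. q \<in> D \<Longrightarrow> norm (a - p) \<le> norm (a - q)"
    by (auto simp: is_arg_min_linorder p_def)
  show "metric_proj D a \<in> D"
    using p by (simp add: p_def)
  show "(a - metric_proj D a) \<bullet> (v - metric_proj D a) \<le> 0" if v: "v \<in> D"
  proof (rule le_if_le_add_mult_small)
    fix t :: real
    assume t: "0 < t" "t < 1"
    have "(1 - t) *\<^sub>R p + t *\<^sub>R v \<in> D"
      using D(3) p v t by (auto simp: convex_alt)
    from min[OF this] have "(norm (a - p))\<^sup>2 \<le> (norm (a - ((1 - t) *\<^sub>R p + t *\<^sub>R v)))\<^sup>2"
      by (simp add: power_mono)
    also have "a - ((1 - t) *\<^sub>R p + t *\<^sub>R v) = (a - p) - t *\<^sub>R (v - p)"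
      by (simp add: algebra_simps)
    also have "(norm ((a - p) - t *\<^sub>R (v - p)))\<^sup>2
        = (norm (a - p))\<^sup>2 - 2 * t * ((a - p) \<bullet> (v - p)) + t\<^sup>2 * (norm (v - p))\<^sup>2"
      by (rule norm_diff_scaleR_sq)
    finally have "t * (2 * ((a - p) \<bullet> (v - p))) \<le> t * (t * (norm (v - p))\<^sup>2)"
      by (simp add: power2_eq_square algebra_simps)
    then show "(a - metric_proj D a) \<bullet> (v - metric_proj D a) \<le> 0 + t * ((norm (v - p))\<^sup>2 / 2)"
      using t by (simp add: p_def)
  qed
qed

text \<open>In a subspace both \<open>?p + v\<close> and \<open>?p - v\<close> are admissible, so
  the obtuse-angle inequality holds with either sign.\<close>

lemma metric_proj_subspace_orthogonal:
  fixes W :: "'a::{real_inner, complete_space} set"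
  assumes W: "closed W" "subspace W" and v: "v \<in> W"
  shows "(a - metric_proj W a) \<bullet> v = 0"
proof -
  let ?p = "metric_proj W a"
  have ne: "W \<noteq> {}"
    using v by blast
  note proj = metric_proj_closed_convex[OF ne W(1) subspace_imp_convex[OF W(2)], where a = a]
  have "?p + v \<in> W" "?p - v \<in> W"
    using proj(1) v W(2) by (auto intro: subspace_add subspace_diff)
  from this[THEN proj(2)] show ?thesis
    by simp
qed

section \<open>Weak sequential compactness\<close>

lemma riesz_representation:
  fixes \<phi> :: "'a::{real_inner, complete_space} \<Rightarrow> real"
  assumes \<phi>: "bounded_linear \<phi>"
  obtains p where "\<And>w. \<phi> w = p \<bullet> w"
proof (cases "\<forall>w. \<phi> w = 0")
  case True
  then show thesis
    using that[of 0] by simp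
next
  case False
  then obtain a where a: "\<phi> a \<noteq> 0"
    by blast
  interpret bounded_linear \<phi>
    by fact
  define K where "K = {w. \<phi> w = 0}"
  have K: "closed K" "subspace K"
    unfolding K_def
    by (auto simp: subspace_def add scaleR zero intro!: closed_Collect_eq continuous_on)
  define q where "q = a - metric_proj K a"
  have orth: "q \<bullet> v = 0" if "\<phi> v = 0" for v
    using metric_proj_subspace_orthogonal[OF K, of v] that by (simp add: q_def K_def)
  have "metric_proj K a \<in> K"
    using K subspace_0[OF K(2)] by (intro metric_proj_in subspace_imp_convex) auto
  then have \<phi>q: "\<phi> q = \<phi> a"
    by (simp add: q_def K_def diff)
  have "q \<noteq> 0"
    using \<phi>q a zero by auto
  \<comment> \<open>The vector on the right lies in the kernel of \<open>\<phi>\<close>, to which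
    \<open>q\<close> is orthogonal; solving for \<open>\<phi> w\<close> yields the representing
    vector.\<close>
  have "q \<bullet> (\<phi> q *\<^sub>R w - \<phi> w *\<^sub>R q) = 0" for w
    by (rule orth) (simp add: diff scaleR)
  then have "\<phi> w = ((\<phi> q / (q \<bullet> q)) *\<^sub>R q) \<bullet> w" for w
    using \<open>q \<noteq> 0\<close> by (simp add: inner_diff_right field_simps)
  then show thesis
    using that by blast
qed

text \<open>The terms of the sequence are countably many test vectors, and against each the inner
  products are bounded reals, so diagonal extraction applies.\<close>

lemma bounded_seq_subseq_inner_convergent:
  fixes X :: "nat \<Rightarrow> 'a::real_inner"
  assumes B: "\<And>n. norm (X n) \<le> B"
  obtains r :: "nat \<Rightarrow> nat" where "strict_mono r" "\<And>m. convergent (\<lambda>k. X (r k) \<bullet> X m)"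
proof -
  interpret subseqs "\<lambda>m s. convergent (\<lambda>k. X (s k) \<bullet> X m)"
  proof
    fix m :: nat and s :: "nat \<Rightarrow> nat"
    assume "strict_mono s"
    have "\<forall>k. X (s k) \<bullet> X m \<in> cball 0 (B * norm (X m))"
    proof
      fix k
      have "\<bar>X (s k) \<bullet> X m\<bar> \<le> norm (X (s k)) * norm (X m)"
        by (rule Cauchy_Schwarz_ineq2)
      also have "\<dots> \<le> B * norm (X m)"
        using B by (intro mult_right_mono) auto
      finally show "X (s k) \<bullet> X m \<in> cball 0 (B * norm (X m))"
        by simp
    qed
    from seq_compactE[OF compact_imp_seq_compact[OF compact_cball] this]
    obtain l r where "strict_mono r" "((\<lambda>k. X (s k) \<bullet> X m) \<circ> r) \<longlonglongrightarrow> l"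
      by metis
    then show "\<exists>r'. strict_mono r' \<and> convergent (\<lambda>k. X ((s \<circ> r') k) \<bullet> X m)"
      by (auto simp: o_def convergent_def)
  qed
  \<comment> \<open>Only the tail of the diagonal sequence from \<open>Suc m\<close> on is a
    subsequence of the one extracted for \<open>m\<close>; convergence ignores the initial
    segment.\<close>
  have *: "convergent (\<lambda>k. X ((diagseq \<circ> (+) (Suc m)) k) \<bullet> X m)" for m
  proof (rule diagseq_holds)
    fix r s :: "nat \<Rightarrow> nat" and n
    assume "strict_mono r" "convergent (\<lambda>k. X (s k) \<bullet> X n)"
    from convergent_subseq_convergent[OF this(2,1)]
    show "convergent (\<lambda>k. X ((s \<circ> r) k) \<bullet> X n)"
      by (simp add: o_def)
  qed
  have "convergent (\<lambda>k. X (diagseq k) \<bullet> X m)" for m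
    using *[of m] convergent_ignore_initial_segment[of "\<lambda>k. X (diagseq k) \<bullet> X m" "Suc m"]
    by (simp add: o_def add.commute add_Suc_right)
  then show thesis
    using that subseq_diagseq by blast
qed

text \<open>Replacing \<open>w\<close> by a nearby \<open>W k\<close> changes all inner products
  uniformly in \<open>n\<close>, by boundedness of \<open>X\<close>; a three-epsilon argument
  follows.\<close>

lemma bounded_seq_closed_inner_convergent:
  fixes X :: "nat \<Rightarrow> 'a::real_inner"
  assumes B: "\<And>n. norm (X n) \<le> B"
  shows "closed {w. convergent (\<lambda>n. X n \<bullet> w)}"
  unfolding closed_sequential_limits
proof safe
  fix W w
  assume W: "\<forall>n. W n \<in> {w. convergent (\<lambda>n. X n \<bullet> w)}" and lim: "W \<longlonglongrightarrow> w"
  have B0: "B \<ge> 0"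
    using B[of 0] norm_ge_zero order_trans by blast
  have "Cauchy (\<lambda>n. X n \<bullet> w)"
  proof (rule metric_CauchyI)
    fix e :: real
    assume e: "e > 0"
    \<comment> \<open>\<open>B + 1\<close> keeps the divisor positive when
      \<open>B = 0\<close>.\<close>
    obtain k where k: "norm (W k - w) < e / (3 * (B + 1))"
      using LIMSEQ_D[OF lim, of "e / (3 * (B + 1))"] e B0 by auto
    have close: "\<bar>X n \<bullet> W k - X n \<bullet> w\<bar> < e / 3" for n
    proof -
      have "\<bar>X n \<bullet> (W k - w)\<bar> \<le> norm (X n) * norm (W k - w)"
        by (rule Cauchy_Schwarz_ineq2)
      also have "\<dots> \<le> (B + 1) * norm (W k - w)"
        using B[of n] by (intro mult_right_mono) auto
      also have "\<dots> < (B + 1) * (e / (3 * (B + 1)))"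
        using k B0 by (intro mult_strict_left_mono) auto
      also have "\<dots> = e / 3"
        using B0 by (simp add: field_simps)
      finally show ?thesis
        by (simp add: inner_diff_right)
    qed
    have "Cauchy (\<lambda>n. X n \<bullet> W k)"
      using W by (auto simp: Cauchy_convergent_iff)
    then obtain K where K: "\<And>m n. m \<ge> K \<Longrightarrow> n \<ge> K \<Longrightarrow> \<bar>X m \<bullet> W k - X n \<bullet> W k\<bar> < e / 3"
      using e unfolding Cauchy_def dist_real_def by (metis zero_less_divide_iff zero_less_numeral)
    have "dist (X m \<bullet> w) (X n \<bullet> w) < e" if "m \<ge> K" "n \<ge> K" for m n
      using K[OF that] close[of m] close[of n] unfolding dist_real_def by linarith
    then show "\<exists>K. \<forall>m\<ge>K. \<forall>n\<ge>K. dist (X m \<bullet> w) (X n \<bullet> w) < e"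
      by blast
  qed
  then show "convergent (\<lambda>n. X n \<bullet> w)"
    by (simp add: Cauchy_convergent_iff)
qed

text \<open>The test vectors with convergent inner products form a closed subspace containing all
  terms, which turns out to be the whole space. The limits then define a functional bounded by
  \<open>B\<close>, and Riesz supplies the weak limit.\<close>

theorem bounded_seq_weakly_convergent_subseq:
  fixes X :: "nat \<Rightarrow> 'a::{real_inner, complete_space}"
  assumes B: "\<And>n. norm (X n) \<le> B"
  obtains r :: "nat \<Rightarrow> nat" and p where "strict_mono r" "weakly_converges (\<lambda>k. X (r k)) p"
proof -
  obtain r :: "nat \<Rightarrow> nat" where r: "strict_mono r" "\<And>m. convergent (\<lambda>k. X (r k) \<bullet> X m)"
    using bounded_seq_subseq_inner_convergent[of X B] B by blast
  define W where "W = {w. convergent (\<lambda>k. X (r k) \<bullet> w)}"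
  have W: "closed W" "subspace W"
    unfolding W_def
    by (rule bounded_seq_closed_inner_convergent[of _ B])
      (auto simp: B subspace_def inner_add_right convergent_const
        intro!: convergent_add convergent_mult)
  \<comment> \<open>The orthogonal complement of \<open>W\<close> annihilates the whole sequence and hence lies in \<open>W\<close>.\<close>
  have conv: "w \<in> W" for w
  proof -
    let ?p = "metric_proj W w"
    have "X (r k) \<bullet> (w - ?p) = 0" for k
      using metric_proj_subspace_orthogonal[OF W, of "X (r k)" w] r(2)
      by (simp add: W_def inner_commute)
    then have "w - ?p \<in> W"
      by (simp add: W_def convergent_const)
    moreover have "?p \<in> W"
      using W subspace_0[OF W(2)] by (intro metric_proj_in subspace_imp_convex) auto
    ultimately show "w \<in> W"
      using subspace_add[OF W(2)] by fastforce
  qed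
  define \<phi> where "\<phi> w = lim (\<lambda>k. X (r k) \<bullet> w)" for w
  have \<phi>: "(\<lambda>k. X (r k) \<bullet> w) \<longlonglongrightarrow> \<phi> w" for w
    using conv[of w] by (simp add: W_def \<phi>_def convergent_LIMSEQ_iff)
  have "bounded_linear \<phi>"
  proof (rule bounded_linear_intro)
    show "\<phi> (v + w) = \<phi> v + \<phi> w" for v w
      using tendsto_add[OF \<phi>[of v] \<phi>[of w]]
      by (intro LIMSEQ_unique[OF \<phi>]) (simp add: inner_add_right)
    show "\<phi> (c *\<^sub>R w) = c *\<^sub>R \<phi> w" for c w
      using tendsto_mult_left[OF \<phi>[of w], of c] by (intro LIMSEQ_unique[OF \<phi>]) simp
    show "norm (\<phi> w) \<le> norm w * B" for w
    proof (rule LIMSEQ_le_const2)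
      show "(\<lambda>k. norm (X (r k) \<bullet> w)) \<longlonglongrightarrow> norm (\<phi> w)"
        by (intro tendsto_norm \<phi>)
      show "\<exists>N. \<forall>k\<ge>N. norm (X (r k) \<bullet> w) \<le> norm w * B"
        using order_trans[OF Cauchy_Schwarz_ineq2 mult_right_mono[OF B norm_ge_zero]]
        by (auto simp: mult.commute)
    qed
  qed
  then obtain p where "\<And>w. \<phi> w = p \<bullet> w"
    by (rule riesz_representation) blast
  then have "weakly_converges (\<lambda>k. X (r k)) p"
    using \<phi> by (simp add: weakly_converges_def)
  with r(1) show thesis
    by (rule that)
qed

text \<open>The halfspace through the projection \<open>?q\<close> with normal
  \<open>d = p - ?q\<close> contains \<open>C\<close>, and its linear inequality survives the weak
  limit. At \<open>p\<close> it reads d \<bullet> d \<le> 0.\<close>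

lemma weakly_converges_closed_convex:
  fixes C :: "'a::{real_inner, complete_space} set"
  assumes C: "closed C" "convex C" and X: "\<And>n. X n \<in> C" "weakly_converges X p"
  shows "p \<in> C"
proof -
  let ?q = "metric_proj C p"
  have "C \<noteq> {}"
    using X(1) by blast
  note q = metric_proj_closed_convex[OF this C, where a = p]
  define d where "d = p - ?q"
  have "d \<bullet> (p - ?q) \<le> 0"
  proof (rule LIMSEQ_le_const2)
    have "(\<lambda>n. X n \<bullet> d - ?q \<bullet> d) \<longlonglongrightarrow> p \<bullet> d - ?q \<bullet> d"
      using X(2) by (intro tendsto_diff tendsto_const) (simp add: weakly_converges_def)
    then show "(\<lambda>n. d \<bullet> (X n - ?q)) \<longlonglongrightarrow> d \<bullet> (p - ?q)"
      by (simp add: inner_diff_right inner_commute[of d])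
  qed (use q(2) X(1) in \<open>auto simp: d_def\<close>)
  then have "p = ?q"
    by (metis d_def inner_ge_zero inner_eq_zero_iff order_antisym right_minus_eq)
  then show ?thesis
    using q(1) by simp
qed

lemma weakly_converges_add_null:
  assumes X: "weakly_converges X p" and Y: "(\<lambda>n. norm (Y n - X n)) \<longlonglongrightarrow> 0"
  shows "weakly_converges Y p"
  unfolding weakly_converges_def
proof
  fix w
  have "(\<lambda>n. Y n - X n) \<longlonglongrightarrow> 0"
    using Y by (rule tendsto_norm_zero_cancel)
  then have "(\<lambda>n. X n \<bullet> w + (Y n - X n) \<bullet> w) \<longlonglongrightarrow> p \<bullet> w + 0 \<bullet> w"
    using X by (intro tendsto_add tendsto_inner[of _ "0"] tendsto_const)
      (simp_all add: weakly_converges_def)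
  then show "(\<lambda>n. Y n \<bullet> w) \<longlonglongrightarrow> p \<bullet> w"
    by (simp flip: inner_add_left)
qed

text \<open>An Opial-type argument: expand \<open>norm (X n - S p)\<close> squared around
  \<open>p\<close> and bound it above through nonexpansiveness. The terms
  \<open>norm (X n - p)\<close> squared cancel, and the cross term vanishes in the weak
  limit.\<close>

lemma nonexpansive_demiclosed:
  assumes S: "nonexpansive_on C S" and X: "\<And>n. X n \<in> C" "weakly_converges X p" and p: "p \<in> C"
    and B: "\<And>n. norm (X n - p) \<le> B"
    and SX: "(\<lambda>n. norm (S (X n) - X n)) \<longlonglongrightarrow> 0"
  shows "S p = p"
proof -
  let ?e = "\<lambda>n. norm (S (X n) - X n)"
  have bound: "(norm (p - S p))\<^sup>2 \<le> ?e n * (?e n + 2 * B) - 2 * (X n \<bullet> (p - S p) - p \<bullet> (p - S p))" for n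
  proof -
    have "norm (X n - S p) \<le> ?e n + norm (S (X n) - S p)"
      using norm_triangle_ineq[of "X n - S (X n)" "S (X n) - S p"] by (simp add: norm_minus_commute)
    also have "\<dots> \<le> ?e n + norm (X n - p)"
      using S X(1) p by (simp add: nonexpansive_on_def)
    finally have "(norm (X n - S p))\<^sup>2 \<le> (?e n + norm (X n - p))\<^sup>2"
      by (simp add: power_mono)
    also have "\<dots> = (norm (X n - p))\<^sup>2 + ?e n * (?e n + 2 * norm (X n - p))"
      by (simp add: power2_eq_square algebra_simps)
    also have "\<dots> \<le> (norm (X n - p))\<^sup>2 + ?e n * (?e n + 2 * B)"
      using B[of n] by (intro add_left_mono mult_left_mono) auto
    finally have "(norm (X n - S p))\<^sup>2 \<le> (norm (X n - p))\<^sup>2 + ?e n * (?e n + 2 * B)" .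
    moreover have "(norm (X n - S p))\<^sup>2
        = (norm (X n - p))\<^sup>2 + 2 * (X n \<bullet> (p - S p) - p \<bullet> (p - S p)) + (norm (p - S p))\<^sup>2"
      by (simp add: power2_norm_eq_inner inner_simps inner_commute algebra_simps)
    ultimately show ?thesis
      by linarith
  qed
  have "(norm (p - S p))\<^sup>2 \<le> 0"
  proof (rule LIMSEQ_le_const)
    have "(\<lambda>n. ?e n * (?e n + 2 * B) - 2 * (X n \<bullet> (p - S p) - p \<bullet> (p - S p)))
        \<longlonglongrightarrow> 0 * (0 + 2 * B) - 2 * (p \<bullet> (p - S p) - p \<bullet> (p - S p))"
      using X(2) by (intro tendsto_add tendsto_diff tendsto_mult tendsto_const SX)
        (simp add: weakly_converges_def)
    then show "(\<lambda>n. ?e n * (?e n + 2 * B) - 2 * (X n \<bullet> (p - S p) - p \<bullet> (p - S p))) \<longlonglongrightarrow> 0"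
      by simp
  qed (use bound in blast)
  then show ?thesis
    by simp
qed

section \<open>Proximal steps\<close>

lemma obtuse_pythagoras:
  fixes p c v :: "'a::real_inner"
  assumes "(c - p) \<bullet> (v - p) \<le> 0"
  shows "(norm (p - c))\<^sup>2 + (norm (v - p))\<^sup>2 \<le> (norm (v - c))\<^sup>2"
  using norm_diff_scaleR_sq[of "c - p" 1 "v - p"] assms by (simp add: norm_minus_commute)

text \<open>Asymmetric on purpose: only the norm of \<open>a\<close> occurs, so in the applications
  boundedness of the iterates is enough.\<close>

lemma norm_sq_diff_le:
  fixes a b :: "'a::real_inner"
  shows "(norm a)\<^sup>2 - (norm b)\<^sup>2 \<le> 2 * norm a * norm (b - a)"
proof -
  have "(norm a)\<^sup>2 - (norm b)\<^sup>2 = 2 * (a \<bullet> (a - b)) - (norm (a - b))\<^sup>2"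
    using norm_diff_scaleR_sq[of a 1 "a - b"] by simp
  also have "\<dots> \<le> 2 * (norm a * norm (a - b))"
    using norm_cauchy_schwarz[of a "a - b"] zero_le_power2[of "norm (a - b)"] by linarith
  finally show ?thesis
    by (simp add: norm_minus_commute)
qed

lemma norm_sq_diff_convex_combination:
  fixes c z v :: "'a::real_inner"
  shows "(norm (c - ((1 - t) *\<^sub>R z + t *\<^sub>R v)))\<^sup>2
    = (1 - t) * (norm (c - z))\<^sup>2 + t * (norm (c - v))\<^sup>2 - t * (1 - t) * (norm (z - v))\<^sup>2"
proof -
  obtain d where d: "(c - z) \<bullet> (v - z) = d"
    by simp
  have eq: "c - ((1 - t) *\<^sub>R z + t *\<^sub>R v) = (c - z) - t *\<^sub>R (v - z)"
    by (simp add: algebra_simps)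
  have cv: "(norm (c - v))\<^sup>2 = (norm (c - z))\<^sup>2 - 2 * d + (norm (v - z))\<^sup>2"
    using norm_diff_scaleR_sq[of "c - z" 1 "v - z"] d by simp
  show ?thesis
    unfolding eq norm_diff_scaleR_sq cv d norm_minus_commute[of z v]
    by (simp add: power2_eq_square[of t] algebra_simps)
qed

text \<open>An infinite value at \<open>z\<close> would exceed the finite objective at
  \<open>v\<close>. The competitors used later are points where the bifunction vanishes on the
  diagonal.\<close>

lemma is_arg_min_prox_finite:
  assumes z: "is_arg_min (prox_objective \<rho> g c) (\<lambda>v. v \<in> C) z" "g z \<noteq> -\<infinity>"
    and v: "v \<in> C" "g v = ereal b" and \<rho>: "0 < \<rho>"
  obtains a where "g z = ereal a"
proof -
  have "prox_objective \<rho> g c z \<le> prox_objective \<rho> g c v"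
    using z(1) v(1) by (simp add: is_arg_min_linorder)
  then show thesis
    using that z(2) v(2) \<rho> by (cases "g z") (auto simp: prox_objective_def)
qed

text \<open>The extra term \<open>\<parallel>z - v\<parallel>\<^sup>2\<close> is the strong convexity of the proximal objective: compare \<open>z\<close> with
  \<open>(1 - t) z + t v\<close>, divide by \<open>t\<close> and let \<open>t \<rightarrow> 0\<close>.\<close>

lemma is_arg_min_prox_three_point:
  fixes C :: "'a::real_inner set"
  assumes C: "convex C" and g: "ereal_convex_on C g" "\<And>y. y \<in> C \<Longrightarrow> g y \<noteq> -\<infinity>"
    and z: "is_arg_min (prox_objective \<rho> g c) (\<lambda>v. v \<in> C) z" "g z = ereal a"
    and v: "v \<in> C" "g v = ereal b" and \<rho>: "0 < \<rho>"
  shows "\<rho> * a + (norm (c - z))\<^sup>2 / 2 + (norm (z - v))\<^sup>2 / 2 \<le> \<rho> * b + (norm (c - v))\<^sup>2 / 2"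
proof (rule le_if_le_add_mult_small)
  fix t :: real
  assume t: "0 < t" "t < 1"
  define w where "w = (1 - t) *\<^sub>R z + t *\<^sub>R v"
  have zC: "z \<in> C"
    using z(1) by (simp add: is_arg_min_def)
  then have w: "w \<in> C"
    using C v(1) t by (auto simp: convex_alt w_def)
  have "g w \<le> ereal (1 - t) * g z + ereal t * g v"
    using g(1) zC v(1) t unfolding ereal_convex_on_def w_def by auto
  then have "g w \<le> ereal ((1 - t) * a + t * b)"
    by (simp add: z(2) v(2))
  then obtain d where d: "g w = ereal d" "d \<le> (1 - t) * a + t * b"
    using g(2)[OF w] by (cases "g w") auto
  have "prox_objective \<rho> g c z \<le> prox_objective \<rho> g c w"
    using z(1) w by (simp add: is_arg_min_linorder)
  then have "\<rho> * a + (norm (c - z))\<^sup>2 / 2 \<le> \<rho> * d + (norm (c - w))\<^sup>2 / 2"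
    by (simp add: prox_objective_def z(2) d(1))
  also have "\<dots> \<le> \<rho> * ((1 - t) * a + t * b) + (norm (c - w))\<^sup>2 / 2"
    using d(2) \<rho> by simp
  also have "(norm (c - w))\<^sup>2
      = (1 - t) * (norm (c - z))\<^sup>2 + t * (norm (c - v))\<^sup>2 - t * (1 - t) * (norm (z - v))\<^sup>2"
    unfolding w_def by (rule norm_sq_diff_convex_combination)
  finally have "t * (\<rho> * a + (norm (c - z))\<^sup>2 / 2 + (norm (z - v))\<^sup>2 / 2)
      \<le> t * (\<rho> * b + (norm (c - v))\<^sup>2 / 2 + t * ((norm (z - v))\<^sup>2 / 2))"
    by (simp add: field_simps)
  then show "\<rho> * a + (norm (c - z))\<^sup>2 / 2 + (norm (z - v))\<^sup>2 / 2
      \<le> \<rho> * b + (norm (c - v))\<^sup>2 / 2 + t * ((norm (z - v))\<^sup>2 / 2)"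
    using t by simp
qed

text \<open>Add the three-point inequality of \<open>y\<close> against \<open>z\<close> to that of
  \<open>z\<close> against \<open>w\<close>. The terms in x - z cancel, A2 replaces f(x,z) by f(x,y)
  + f(y,z) at the cost of the \<open>c1\<close> and \<open>c2\<close> terms, and pseudomonotonicity
  makes f(y,w) nonpositive.\<close>

lemma extragradient_estimate:
  fixes C :: "'a::real_inner set"
  assumes C: "convex C" and f: "bifunction_on C f" "pseudomonotone_on C f"
      "lipschitz_type_on c1 c2 C f" "\<And>v. v \<in> C \<Longrightarrow> ereal_convex_on C (f v)"
    and \<rho>: "0 < \<rho>" and x: "x \<in> C" and w: "w \<in> EP C f"
    and y: "is_arg_min (prox_objective \<rho> (f x) x) (\<lambda>v. v \<in> C) y"
    and z: "is_arg_min (prox_objective \<rho> (f y) x) (\<lambda>v. v \<in> C) z"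
  shows "(norm (z - w))\<^sup>2 \<le> (norm (x - w))\<^sup>2
    - (1 - 2 * \<rho> * c1) * (norm (y - x))\<^sup>2 - (1 - 2 * \<rho> * c2) * (norm (z - y))\<^sup>2"
proof -
  have yC: "y \<in> C" and zC: "z \<in> C" and wC: "w \<in> C"
    using y z w by (auto simp: is_arg_min_def EP_def)
  have ninf: "\<And>u v. u \<in> C \<Longrightarrow> v \<in> C \<Longrightarrow> f u v \<noteq> -\<infinity>" and zero: "\<And>u. u \<in> C \<Longrightarrow> f u u = ereal 0"
    using f(1) by (auto simp: bifunction_on_def zero_ereal_def)
  obtain a where a: "f x y = ereal a"
    using is_arg_min_prox_finite[OF y ninf[OF x yC] x zero[OF x] \<rho>] by metis
  obtain b where b: "f y z = ereal b"
    using is_arg_min_prox_finite[OF z ninf[OF yC zC] yC zero[OF yC] \<rho>] by metis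
  have "f y w \<le> 0"
    using w f(2) yC wC by (auto simp: EP_def pseudomonotone_on_def)
  then obtain d where d: "f y w = ereal d" "d \<le> 0"
    using ninf[OF yC wC] by (cases "f y w") auto
  have lip: "f x y + f y z \<ge> f x z - ereal (c1 * (norm (x - y))\<^sup>2) - ereal (c2 * (norm (y - z))\<^sup>2)"
    using f(3) x yC zC by (auto simp: lipschitz_type_on_def)
  \<comment> \<open>The finite left-hand side of A2 excludes f(x,z) = \<infinity>, which makes
    \<open>z\<close> an admissible competitor for \<open>y\<close>.\<close>
  then obtain e where e: "f x z = ereal e"
      "a + b \<ge> e - c1 * (norm (x - y))\<^sup>2 - c2 * (norm (y - z))\<^sup>2"
    using ninf[OF x zC] a b by (cases "f x z") auto
  have "\<rho> * a + (norm (x - y))\<^sup>2 / 2 + (norm (y - z))\<^sup>2 / 2 \<le> \<rho> * e + (norm (x - z))\<^sup>2 / 2"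
    by (rule is_arg_min_prox_three_point[OF C f(4)[OF x] ninf[OF x] y a zC e(1) \<rho>])
  moreover have "\<rho> * b + (norm (x - z))\<^sup>2 / 2 + (norm (z - w))\<^sup>2 / 2 \<le> \<rho> * d + (norm (x - w))\<^sup>2 / 2"
    by (rule is_arg_min_prox_three_point[OF C f(4)[OF yC] ninf[OF yC] z b wC d(1) \<rho>])
  moreover have "\<rho> * d \<le> 0"
    using d(2) \<rho> by (simp add: mult_nonneg_nonpos)
  moreover have "\<rho> * e \<le> \<rho> * (a + b + c1 * (norm (x - y))\<^sup>2 + c2 * (norm (y - z))\<^sup>2)"
    using e(2) \<rho> by (intro mult_left_mono) auto
  ultimately show ?thesis
    by (simp add: norm_minus_commute algebra_simps)
qed

text \<open>Minimality of \<open>Y n\<close> gives f(X n, Y n) \<le> f(X n, v) up to a null term.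
  Both arguments on the left converge weakly to \<open>p\<close>, so A3 yields 0 = f(p,p) \<le>
  f(p,v).\<close>

lemma weak_limit_of_prox_in_EP:
  fixes C :: "'a::real_inner set"
  assumes C: "convex C" and f: "bifunction_on C f" "weakly_continuous_on C f"
      "\<And>v. v \<in> C \<Longrightarrow> ereal_convex_on C (f v)"
    and \<rho>: "0 < \<rho>" and X: "\<And>n. X n \<in> C" "weakly_converges X p" and p: "p \<in> C"
    and B: "\<And>n. norm (X n) \<le> B"
    and Y: "\<And>n. is_arg_min (prox_objective \<rho> (f (X n)) (X n)) (\<lambda>v. v \<in> C) (Y n)"
    and YX: "(\<lambda>n. norm (Y n - X n)) \<longlonglongrightarrow> 0"
  shows "p \<in> EP C f"
  unfolding EP_def
proof safe
  fix v
  assume v: "v \<in> C"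
  have YC: "Y n \<in> C" for n
    using Y[of n] by (simp add: is_arg_min_def)
  have ninf: "\<And>u v. u \<in> C \<Longrightarrow> v \<in> C \<Longrightarrow> f u v \<noteq> -\<infinity>" and zero: "\<And>u. u \<in> C \<Longrightarrow> f u u = ereal 0"
    using f(1) by (auto simp: bifunction_on_def zero_ereal_def)
  \<comment> \<open>Half of the bound in \<open>norm_sq_diff_le\<close> for \<open>X n - v\<close>
    and \<open>Y n - v\<close>, with \<open>norm (X n - v)\<close> at most
    \<open>B + norm v\<close>, divided by \<open>\<rho>\<close>.\<close>
  let ?e = "\<lambda>n. (B + norm v) / \<rho> * norm (Y n - X n)"
  have ineq: "f (X n) (Y n) \<le> f (X n) v + ereal (?e n)" for n
  proof -
    obtain a where a: "f (X n) (Y n) = ereal a"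
      using is_arg_min_prox_finite[OF Y[of n] ninf[OF X(1) YC] X(1) zero[OF X(1)] \<rho>] by metis
    show ?thesis
    proof (cases "f (X n) v")
      case (real b)
      from is_arg_min_prox_three_point[OF C f(3)[OF X(1)] ninf[OF X(1)] Y a v real \<rho>]
      have "\<rho> * a + (norm (Y n - v))\<^sup>2 / 2 \<le> \<rho> * b + (norm (X n - v))\<^sup>2 / 2"
        using zero_le_power2[of "norm (X n - Y n)"] by linarith
      moreover have "(norm (X n - v))\<^sup>2 - (norm (Y n - v))\<^sup>2 \<le> 2 * norm (X n - v) * norm (Y n - X n)"
        using norm_sq_diff_le[of "X n - v" "Y n - v"] by simp
      moreover have "norm (X n - v) * norm (Y n - X n) \<le> (B + norm v) * norm (Y n - X n)"
        using norm_triangle_ineq4[of "X n" v] B[of n] by (intro mult_right_mono) auto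
      ultimately have "\<rho> * a \<le> \<rho> * b + (B + norm v) * norm (Y n - X n)"
        by linarith
      then show ?thesis
        using \<rho> by (simp add: a real field_simps)
    qed (use ninf[OF X(1) v] in auto)
  qed
  show "0 \<le> f p v"
  proof (cases "f p v")
    case (real c)
    have weak_Y: "weakly_converges Y p"
      by (rule weakly_converges_add_null[OF X(2) YX])
    have weak_v: "weakly_converges (\<lambda>_. v) v"
      by (simp add: weakly_converges_def)
    have "(\<lambda>n. f (X n) (Y n)) \<longlonglongrightarrow> f p p"
      using f(2) X p YC weak_Y by (auto simp: weakly_continuous_on_def)
    moreover have "(\<lambda>n. f (X n) v + ereal (?e n)) \<longlonglongrightarrow> f p v + ereal 0"
    proof (rule tendsto_add_ereal)
      show "(\<lambda>n. f (X n) v) \<longlonglongrightarrow> f p v"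
        using f(2)[unfolded weakly_continuous_on_def, rule_format, OF p v, of X "\<lambda>_. v"]
          X v weak_v by auto
      show "(\<lambda>n. ereal (?e n)) \<longlonglongrightarrow> ereal 0"
        using tendsto_mult_left[OF YX, of "(B + norm v) / \<rho>"] by simp
    qed (auto simp: real)
    ultimately have "f p p \<le> f p v + ereal 0"
      by (rule LIMSEQ_le) (use ineq in blast)
    then show ?thesis
      using zero[OF p] by (simp add: zero_ereal_def[symmetric])
  qed (use ninf[OF p v] in auto)
qed (fact p)

section \<open>The outer approximation\<close>

text \<open>This is the intersection of C_n and Q_n, written as in
  \<open>mann_extragradient_step\<close> so that unfolding identifies the two.\<close>

definition mann_outer_set :: "'a::real_inner set \<Rightarrow> 'a \<Rightarrow> 'a \<Rightarrow> 'a \<Rightarrow> 'a set" where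
  "mann_outer_set C x0 x u
    = {v \<in> C. norm (u - v) \<le> norm (x - v)} \<inter> {v \<in> C. (x0 - x) \<bullet> (v - x) \<le> 0}"

text \<open>After squaring, \<open>norm v\<close> squared cancels from the comparison of distances,
  so both conditions cut \<open>C\<close> by halfspaces.\<close>

lemma mann_outer_set_closed_convex:
  assumes C: "closed C" "convex C"
  shows "closed (mann_outer_set C x0 x u)" "convex (mann_outer_set C x0 x u)"
proof -
  have "norm (u - v) \<le> norm (x - v) \<longleftrightarrow> (x - u) \<bullet> v \<le> ((norm x)\<^sup>2 - (norm u)\<^sup>2) / 2" for v
  proof -
    have "norm (u - v) \<le> norm (x - v) \<longleftrightarrow> (norm (u - v))\<^sup>2 \<le> (norm (x - v))\<^sup>2"
      by simp
    also have "(norm (u - v))\<^sup>2 = (norm u)\<^sup>2 - 2 * (u \<bullet> v) + (norm v)\<^sup>2"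
      using norm_diff_scaleR_sq[of u 1 v] by simp
    also have "(norm (x - v))\<^sup>2 = (norm x)\<^sup>2 - 2 * (x \<bullet> v) + (norm v)\<^sup>2"
      using norm_diff_scaleR_sq[of x 1 v] by simp
    finally show ?thesis
      by (simp add: inner_diff_left field_simps)
  qed
  then have "mann_outer_set C x0 x u = C \<inter> {v. (x - u) \<bullet> v \<le> ((norm x)\<^sup>2 - (norm u)\<^sup>2) / 2}
      \<inter> {v. (x0 - x) \<bullet> v \<le> (x0 - x) \<bullet> x}"
    by (auto simp: mann_outer_set_def inner_diff_right)
  then show "closed (mann_outer_set C x0 x u)" "convex (mann_outer_set C x0 x u)"
    by (simp_all only: C closed_Int convex_Int closed_halfspace_le convex_halfspace_le)
qed

text \<open>The points and indices that are existentially quantified in each step become fixed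
  sequences here, so that their limits can be discussed.\<close>

locale mann_extragradient_run =
  fixes C :: "'a::{real_inner, complete_space} set"
    and N M :: nat
    and f :: "nat \<Rightarrow> 'a \<Rightarrow> 'a \<Rightarrow> ereal"
    and S :: "nat \<Rightarrow> 'a \<Rightarrow> 'a"
    and c1 c2 \<rho> :: real
    and \<alpha> :: "nat \<Rightarrow> real"
    and x0 :: 'a
    and x :: "nat \<Rightarrow> 'a"
    and F :: "'a set"
    and y z u :: "nat \<Rightarrow> nat \<Rightarrow> 'a"
    and i0 j0 :: "nat \<Rightarrow> nat"
  assumes C: "closed C" "convex C"
    and NM: "N \<ge> 1" "M \<ge> 1"
    and bifunction: "\<And>i. i \<in> {1..N} \<Longrightarrow> bifunction_on C (f i)"
    and A1: "\<And>i. i \<in> {1..N} \<Longrightarrow> pseudomonotone_on C (f i)"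
    and c_pos: "c1 > 0" "c2 > 0"
    and A2: "\<And>i. i \<in> {1..N} \<Longrightarrow> lipschitz_type_on c1 c2 C (f i)"
    and A3: "\<And>i. i \<in> {1..N} \<Longrightarrow> weakly_continuous_on C (f i)"
    and A4: "\<And>i v. i \<in> {1..N} \<Longrightarrow> v \<in> C \<Longrightarrow> ereal_convex_on C (f i v)"
    and S: "\<And>j. j \<in> {1..M} \<Longrightarrow> nonexpansive_on C (S j)"
    and F_def: "F = (\<Inter>i\<in>{1..N}. EP C (f i)) \<inter> (\<Inter>j\<in>{1..M}. fixed_points C (S j))"
    and F_nonempty: "F \<noteq> {}"
    and x0: "x0 \<in> C"
    and rho: "0 < \<rho>" "\<rho> < min (1 / (2 * c1)) (1 / (2 * c2))"
    and alpha: "\<And>n. 0 < \<alpha> n \<and> \<alpha> n < 1"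
    and alpha_limsup: "limsup (\<lambda>n. ereal (\<alpha> n)) < 1"
    and x_0: "x 0 = x0"
    and y: "\<And>n i. i \<in> {1..N} \<Longrightarrow>
               is_arg_min (prox_objective \<rho> (f i (x n)) (x n)) (\<lambda>v. v \<in> C) (y n i)"
    and z: "\<And>n i. i \<in> {1..N} \<Longrightarrow>
               is_arg_min (prox_objective \<rho> (f i (y n i)) (x n)) (\<lambda>v. v \<in> C) (z n i)"
    and i0: "\<And>n. is_arg_max (\<lambda>i. norm (z n i - x n)) (\<lambda>i. i \<in> {1..N}) (i0 n)"
    and u: "\<And>n j. j \<in> {1..M} \<Longrightarrow> u n j = \<alpha> n *\<^sub>R x n + (1 - \<alpha> n) *\<^sub>R S j (z n (i0 n))"
    and j0: "\<And>n. is_arg_max (\<lambda>j. norm (u n j - x n)) (\<lambda>j. j \<in> {1..M}) (j0 n)"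
    and x_Suc: "\<And>n. x (Suc n) = metric_proj (mann_outer_set C x0 (x n) (u n (j0 n))) x0"
begin

section \<open>Estimates towards points of F and well-definedness of the iteration\<close>

lemma F_subset: "F \<subseteq> C"
  using NM(1) by (auto simp: F_def EP_def)

lemma F_EP: "w \<in> F \<Longrightarrow> i \<in> {1..N} \<Longrightarrow> w \<in> EP C (f i)"
  by (auto simp: F_def)

lemma F_fixed: "w \<in> F \<Longrightarrow> j \<in> {1..M} \<Longrightarrow> S j w = w"
  by (auto simp: F_def fixed_points_def)

lemma z_in: "i \<in> {1..N} \<Longrightarrow> z n i \<in> C"
  using z[of i n] by (simp add: is_arg_min_def)

lemma i0_in: "i0 n \<in> {1..N}"
  using i0[of n] by (simp add: is_arg_max_def)

lemma j0_in: "j0 n \<in> {1..M}"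
  using j0[of n] by (simp add: is_arg_max_def)

text \<open>The upper bound on \<open>\<rho>\<close> is what makes both coefficients in
  \<open>extragradient_estimate\<close> positive.\<close>

lemma kappa:
  obtains \<kappa> where "0 < \<kappa>" "\<kappa> \<le> 1 - 2 * \<rho> * c1" "\<kappa> \<le> 1 - 2 * \<rho> * c2"
proof (rule that)
  show "0 < min (1 - 2 * \<rho> * c1) (1 - 2 * \<rho> * c2)"
    using rho c_pos by (simp add: field_simps)
qed auto

lemma z_estimate:
  assumes "x n \<in> C" "w \<in> F" "i \<in> {1..N}"
  shows "(norm (z n i - w))\<^sup>2 \<le> (norm (x n - w))\<^sup>2
    - (1 - 2 * \<rho> * c1) * (norm (y n i - x n))\<^sup>2 - (1 - 2 * \<rho> * c2) * (norm (z n i - y n i))\<^sup>2"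
  by (rule extragradient_estimate[OF C(2) bifunction A1 A2 A4 rho(1) assms(1) F_EP y z])
    (use assms in auto)

lemma z_le:
  assumes "x n \<in> C" "w \<in> F" "i \<in> {1..N}"
  shows "norm (z n i - w) \<le> norm (x n - w)"
proof -
  obtain \<kappa> where \<kappa>: "0 < \<kappa>" "\<kappa> \<le> 1 - 2 * \<rho> * c1" "\<kappa> \<le> 1 - 2 * \<rho> * c2"
    by (rule kappa)
  then have "0 \<le> (1 - 2 * \<rho> * c1) * (norm (y n i - x n))\<^sup>2"
    "0 \<le> (1 - 2 * \<rho> * c2) * (norm (z n i - y n i))\<^sup>2"
    by (intro mult_nonneg_nonneg; simp)+
  with z_estimate[OF assms] have "(norm (z n i - w))\<^sup>2 \<le> (norm (x n - w))\<^sup>2"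
    by linarith
  then show ?thesis
    by (rule power2_le_imp_le) simp
qed

lemma S_z_le:
  assumes "x n \<in> C" "w \<in> F" "j \<in> {1..M}"
  shows "norm (S j (z n (i0 n)) - w) \<le> norm (z n (i0 n) - w)"
  using S[OF assms(3)] z_in[OF i0_in] F_fixed[OF assms(2,3)] F_subset assms(2)
  unfolding nonexpansive_on_def by (metis subsetD)

lemma u_le:
  assumes "x n \<in> C" "w \<in> F" "j \<in> {1..M}"
  shows "norm (u n j - w) \<le> norm (x n - w)"
proof -
  have "u n j - w = \<alpha> n *\<^sub>R (x n - w) + (1 - \<alpha> n) *\<^sub>R (S j (z n (i0 n)) - w)"
    by (simp add: u[OF assms(3)] algebra_simps)
  also have "norm \<dots> \<le> \<alpha> n * norm (x n - w) + (1 - \<alpha> n) * norm (S j (z n (i0 n)) - w)"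
    using norm_triangle_ineq[of "\<alpha> n *\<^sub>R (x n - w)" "(1 - \<alpha> n) *\<^sub>R (S j (z n (i0 n)) - w)"]
      alpha[of n] by simp
  also have "\<dots> \<le> \<alpha> n * norm (x n - w) + (1 - \<alpha> n) * norm (x n - w)"
    using order_trans[OF S_z_le[OF assms] z_le[OF assms(1,2) i0_in]] alpha[of n]
    by (intro add_left_mono mult_left_mono) auto
  finally show ?thesis
    by (simp add: algebra_simps)
qed

abbreviation "D n \<equiv> mann_outer_set C x0 (x n) (u n (j0 n))"

text \<open>A joint induction: \<open>F\<close> inside \<open>D n\<close> makes the projection
  \<open>x (Suc n)\<close> meaningful, and its obtuse-angle property towards \<open>F\<close> is
  exactly the Q-condition of the next step. The C-condition comes from \<open>u_le\<close>.\<close>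

lemma invariant: "x n \<in> C \<and> F \<subseteq> D n"
proof (induction n)
  case 0
  show ?case
    using F_subset x0 u_le[OF _ _ j0_in, of 0] by (auto simp: mann_outer_set_def x_0)
next
  case (Suc n)
  have "D n \<noteq> {}"
    using Suc F_nonempty by auto
  note proj = metric_proj_closed_convex[OF this mann_outer_set_closed_convex[OF C], where a = x0]
  have xC: "x (Suc n) \<in> C"
    using proj(1) by (simp add: x_Suc mann_outer_set_def)
  moreover have "(x0 - x (Suc n)) \<bullet> (w - x (Suc n)) \<le> 0" if "w \<in> F" for w
    using proj(2)[of w] that Suc by (auto simp: x_Suc)
  ultimately show ?case
    using F_subset u_le[OF xC _ j0_in] by (auto simp: mann_outer_set_def)
qed

lemma x_in: "x n \<in> C"
  using invariant by blast

lemma F_obtuse: "w \<in> F \<Longrightarrow> (x0 - x n) \<bullet> (w - x n) \<le> 0"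
  using invariant[of n] by (auto simp: mann_outer_set_def)

lemma x_Suc_in: "x (Suc n) \<in> D n"
  unfolding x_Suc using invariant[of n] F_nonempty
  by (intro metric_proj_in mann_outer_set_closed_convex C) auto

lemma F_pythagoras: "w \<in> F \<Longrightarrow> (norm (x n - x0))\<^sup>2 + (norm (w - x n))\<^sup>2 \<le> (norm (w - x0))\<^sup>2"
  by (intro obtuse_pythagoras F_obtuse)

lemma x_bounded:
  assumes "w \<in> F"
  shows "norm (x n - w) \<le> norm (w - x0)"
proof -
  have "(norm (w - x n))\<^sup>2 \<le> (norm (w - x0))\<^sup>2"
    using F_pythagoras[OF assms, of n] zero_le_power2[of "norm (x n - x0)"] by linarith
  then show ?thesis
    by (simp add: norm_minus_commute)
qed

section \<open>Asymptotic regularity: all residuals vanish\<close>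

lemma x_step: "(norm (x n - x0))\<^sup>2 + (norm (x (Suc n) - x n))\<^sup>2 \<le> (norm (x (Suc n) - x0))\<^sup>2"
  using x_Suc_in[of n] by (intro obtuse_pythagoras) (simp add: mann_outer_set_def)

lemma norm_x_convergent: "convergent (\<lambda>n. (norm (x n - x0))\<^sup>2)"
proof -
  obtain w where w: "w \<in> F"
    using F_nonempty by blast
  have "incseq (\<lambda>n. (norm (x n - x0))\<^sup>2)"
  proof (rule incseq_SucI)
    show "(norm (x n - x0))\<^sup>2 \<le> (norm (x (Suc n) - x0))\<^sup>2" for n
      using x_step[of n] zero_le_power2[of "norm (x (Suc n) - x n)"] by linarith
  qed
  moreover have "(norm (x n - x0))\<^sup>2 \<le> (norm (w - x0))\<^sup>2" for n
    using F_pythagoras[OF w, of n] zero_le_power2[of "norm (w - x n)"] by linarith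
  ultimately show ?thesis
    using incseq_convergent unfolding convergent_def by blast
qed

lemma x_Suc_diff: "(\<lambda>n. norm (x (Suc n) - x n)) \<longlonglongrightarrow> 0"
proof -
  let ?g = "\<lambda>n. (norm (x n - x0))\<^sup>2"
  obtain l where l: "?g \<longlonglongrightarrow> l"
    using norm_x_convergent unfolding convergent_def by blast
  have bound: "norm ((norm (x (Suc n) - x n))\<^sup>2) \<le> ?g (Suc n) - ?g n" for n
    using x_step[of n] by simp
  have "(\<lambda>n. ?g (Suc n) - ?g n) \<longlonglongrightarrow> 0"
    using tendsto_diff[OF LIMSEQ_Suc[OF l] l] by simp
  then have "(\<lambda>n. (norm (x (Suc n) - x n))\<^sup>2) \<longlonglongrightarrow> 0"
    by (rule Lim_null_comparison[OF always_eventually, rotated]) (use bound in blast)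
  then show ?thesis
    by simp
qed

text \<open>Maximality of \<open>j0 n\<close> reduces every \<open>j\<close> to the selected index;
  the factor 2 is the triangle inequality through \<open>x (Suc n)\<close>, which lies in
  C_n.\<close>

lemma u_diff:
  assumes j: "j \<in> {1..M}"
  shows "norm (u n j - x n) \<le> 2 * norm (x (Suc n) - x n)"
proof -
  have "norm (u n j - x n) \<le> norm (u n (j0 n) - x n)"
    using j0[of n] j by (simp add: is_arg_max_linorder)
  also have "\<dots> \<le> norm (u n (j0 n) - x (Suc n)) + norm (x (Suc n) - x n)"
    using norm_triangle_ineq[of "u n (j0 n) - x (Suc n)" "x (Suc n) - x n"] by simp
  also have "norm (u n (j0 n) - x (Suc n)) \<le> norm (x (Suc n) - x n)"
    using x_Suc_in[of n] by (simp add: mann_outer_set_def norm_minus_commute)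
  finally show ?thesis
    by simp
qed

lemma alpha_away_from_1:
  obtains \<delta> where "\<delta> > 0" "eventually (\<lambda>n. \<delta> \<le> 1 - \<alpha> n) sequentially"
proof -
  obtain r where r: "limsup (\<lambda>n. ereal (\<alpha> n)) < ereal r" "ereal r < 1"
    using ereal_dense2[OF alpha_limsup] by blast
  have "eventually (\<lambda>n. ereal (\<alpha> n) < ereal r) sequentially"
    by (rule Limsup_lessD[OF r(1)])
  then show thesis
    using r(2) by (intro that[of "1 - r"]) (auto elim!: eventually_mono)
qed

lemma S_z_diff:
  assumes j: "j \<in> {1..M}"
  shows "(\<lambda>n. norm (S j (z n (i0 n)) - x n)) \<longlonglongrightarrow> 0"
proof -
  obtain \<delta> where \<delta>: "\<delta> > 0" "eventually (\<lambda>n. \<delta> \<le> 1 - \<alpha> n) sequentially"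
    by (rule alpha_away_from_1)
  \<comment> \<open>The 2 is the constant of \<open>u_diff\<close>; 1 / \<delta> comes from dividing
    u_n^j - x_n by 1 - \<alpha>_n.\<close>
  have "(\<lambda>n. 2 / \<delta> * norm (x (Suc n) - x n)) \<longlonglongrightarrow> 0"
    by (rule tendsto_mult_right_zero[OF x_Suc_diff])
  then show ?thesis
  proof (rule Lim_null_comparison[rotated])
    show "\<forall>\<^sub>F n in sequentially. norm (norm (S j (z n (i0 n)) - x n)) \<le> 2 / \<delta> * norm (x (Suc n) - x n)"
      using \<delta>(2)
    proof eventually_elim
      case (elim n)
      have "u n j - x n = (1 - \<alpha> n) *\<^sub>R (S j (z n (i0 n)) - x n)"
        by (simp add: u[OF j] algebra_simps)
      then have "(1 - \<alpha> n) * norm (S j (z n (i0 n)) - x n) = norm (u n j - x n)"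
        using alpha[of n] by simp
      moreover have "\<delta> * norm (S j (z n (i0 n)) - x n) \<le> (1 - \<alpha> n) * norm (S j (z n (i0 n)) - x n)"
        using elim by (intro mult_right_mono) auto
      ultimately show ?case
        using u_diff[OF j, of n] \<delta>(1) by (simp add: field_simps)
    qed
  qed
qed

lemma sum_sq_diff_bound:
  obtains K where "\<And>n i w. i \<in> {1..N} \<Longrightarrow> w \<in> F \<Longrightarrow>
    (norm (y n i - x n))\<^sup>2 + (norm (z n i - y n i))\<^sup>2 \<le> K * ((norm (x n - w))\<^sup>2 - (norm (z n i - w))\<^sup>2)"
proof -
  obtain \<kappa> where \<kappa>: "0 < \<kappa>" "\<kappa> \<le> 1 - 2 * \<rho> * c1" "\<kappa> \<le> 1 - 2 * \<rho> * c2"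
    by (rule kappa)
  show thesis
  proof (rule that)
    fix n i w
    assume i: "i \<in> {1..N}" and w: "w \<in> F"
    have "\<kappa> * (norm (y n i - x n))\<^sup>2 \<le> (1 - 2 * \<rho> * c1) * (norm (y n i - x n))\<^sup>2"
      "\<kappa> * (norm (z n i - y n i))\<^sup>2 \<le> (1 - 2 * \<rho> * c2) * (norm (z n i - y n i))\<^sup>2"
      using \<kappa> by (intro mult_right_mono; simp)+
    with z_estimate[OF x_in w i, of n] have
      "\<kappa> * ((norm (y n i - x n))\<^sup>2 + (norm (z n i - y n i))\<^sup>2)
        \<le> (norm (x n - w))\<^sup>2 - (norm (z n i - w))\<^sup>2"
      unfolding distrib_left by linarith
    then show "(norm (y n i - x n))\<^sup>2 + (norm (z n i - y n i))\<^sup>2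
        \<le> 1 / \<kappa> * ((norm (x n - w))\<^sup>2 - (norm (z n i - w))\<^sup>2)"
      using \<kappa>(1) by (simp add: field_simps)
  qed
qed

text \<open>\<open>S_z_le\<close> replaces \<open>z n (i0 n)\<close> by its image under
  \<open>S 1\<close> in the gap of squared distances to \<open>w\<close>, and that image is already
  known to approach \<open>x n\<close>. Maximality of \<open>i0 n\<close> then covers every
  \<open>i\<close>.\<close>

lemma z_diff:
  assumes i: "i \<in> {1..N}"
  shows "(\<lambda>n. norm (z n i - x n)) \<longlonglongrightarrow> 0"
proof -
  obtain w where w: "w \<in> F"
    using F_nonempty by blast
  obtain K where K: "\<And>n i w. i \<in> {1..N} \<Longrightarrow> w \<in> F \<Longrightarrow>
      (norm (y n i - x n))\<^sup>2 + (norm (z n i - y n i))\<^sup>2 \<le> K * ((norm (x n - w))\<^sup>2 - (norm (z n i - w))\<^sup>2)"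
    using sum_sq_diff_bound by blast
  have j: "1 \<in> {1..M}"
    using NM(2) by simp
  let ?s = "\<lambda>n. norm (S 1 (z n (i0 n)) - x n)"
  \<comment> \<open>The first 2 is from (a + b)^2 \<le> 2 (a^2 + b^2); the bracket is from
    \<open>norm_sq_diff_le\<close> and \<open>x_bounded\<close>. The absolute value is taken since
    nothing is recorded about the sign of \<open>K\<close>.\<close>
  define B where "B = 2 * \<bar>K\<bar> * (2 * norm (w - x0))"
  have bound: "norm ((norm (z n i - x n))\<^sup>2) \<le> B * ?s n" for n
  proof -
    let ?z = "z n (i0 n)" and ?y = "y n (i0 n)"
    have "norm (z n i - x n) \<le> norm (?z - x n)"
      using i0[of n] i by (simp add: is_arg_max_linorder)
    then have "(norm (z n i - x n))\<^sup>2 \<le> (norm (?z - x n))\<^sup>2"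
      by (simp add: power_mono)
    also have "\<dots> \<le> (norm (?z - ?y) + norm (?y - x n))\<^sup>2"
      using norm_triangle_ineq[of "?z - ?y" "?y - x n"] by (simp add: power_mono)
    also have "\<dots> \<le> 2 * ((norm (?y - x n))\<^sup>2 + (norm (?z - ?y))\<^sup>2)"
      using zero_le_power2[of "norm (?z - ?y) - norm (?y - x n)"]
      by (simp add: power2_eq_square algebra_simps)
    also have "\<dots> \<le> 2 * (K * ((norm (x n - w))\<^sup>2 - (norm (?z - w))\<^sup>2))"
      using K[OF i0_in[of n] w, of n] by simp
    also have "\<dots> \<le> 2 * (\<bar>K\<bar> * ((norm (x n - w))\<^sup>2 - (norm (?z - w))\<^sup>2))"
      using z_le[OF x_in w i0_in] by (simp add: mult_right_mono power_mono)
    also have "(norm (x n - w))\<^sup>2 - (norm (?z - w))\<^sup>2 \<le> (norm (x n - w))\<^sup>2 - (norm (S 1 ?z - w))\<^sup>2"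
      using S_z_le[OF x_in w j] by (simp add: power_mono)
    also have "\<dots> \<le> 2 * norm (x n - w) * ?s n"
      using norm_sq_diff_le[of "x n - w" "S 1 ?z - w"] by simp
    also have "\<dots> \<le> 2 * norm (w - x0) * ?s n"
      using x_bounded[OF w] by (intro mult_right_mono) auto
    finally show ?thesis
      by (simp add: B_def mult_left_mono mult.assoc)
  qed
  have "(\<lambda>n. B * ?s n) \<longlonglongrightarrow> 0"
    by (rule tendsto_mult_right_zero[OF S_z_diff[OF j]])
  then have "(\<lambda>n. (norm (z n i - x n))\<^sup>2) \<longlonglongrightarrow> 0"
    by (rule Lim_null_comparison[OF always_eventually, rotated]) (use bound in blast)
  then show ?thesis
    by simp
qed

text \<open>Once \<open>z n i - x n\<close> is null, so is the gap of squared distances for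
  \<open>i\<close> itself, and the same proximal bound now controls \<open>y n i\<close>.\<close>

lemma y_diff:
  assumes i: "i \<in> {1..N}"
  shows "(\<lambda>n. norm (y n i - x n)) \<longlonglongrightarrow> 0"
proof -
  obtain w where w: "w \<in> F"
    using F_nonempty by blast
  obtain K where K: "\<And>n i w. i \<in> {1..N} \<Longrightarrow> w \<in> F \<Longrightarrow>
      (norm (y n i - x n))\<^sup>2 + (norm (z n i - y n i))\<^sup>2 \<le> K * ((norm (x n - w))\<^sup>2 - (norm (z n i - w))\<^sup>2)"
    using sum_sq_diff_bound by blast
  define B where "B = \<bar>K\<bar> * (2 * norm (w - x0))"
  have bound: "norm ((norm (y n i - x n))\<^sup>2) \<le> B * norm (z n i - x n)" for n
  proof -
    have "(norm (y n i - x n))\<^sup>2 \<le> K * ((norm (x n - w))\<^sup>2 - (norm (z n i - w))\<^sup>2)"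
      using K[OF i w, of n] zero_le_power2[of "norm (z n i - y n i)"] by linarith
    also have "\<dots> \<le> \<bar>K\<bar> * ((norm (x n - w))\<^sup>2 - (norm (z n i - w))\<^sup>2)"
      using z_le[OF x_in w i] by (simp add: mult_right_mono power_mono)
    also have "(norm (x n - w))\<^sup>2 - (norm (z n i - w))\<^sup>2 \<le> 2 * norm (x n - w) * norm (z n i - x n)"
      using norm_sq_diff_le[of "x n - w" "z n i - w"] by simp
    also have "\<dots> \<le> 2 * norm (w - x0) * norm (z n i - x n)"
      using x_bounded[OF w] by (intro mult_right_mono) auto
    finally show ?thesis
      by (simp add: B_def mult_left_mono mult.assoc)
  qed
  have "(\<lambda>n. B * norm (z n i - x n)) \<longlonglongrightarrow> 0"
    by (rule tendsto_mult_right_zero[OF z_diff[OF i]])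
  then have "(\<lambda>n. (norm (y n i - x n))\<^sup>2) \<longlonglongrightarrow> 0"
    by (rule Lim_null_comparison[OF always_eventually, rotated]) (use bound in blast)
  then show ?thesis
    by simp
qed

lemma S_x_diff:
  assumes j: "j \<in> {1..M}"
  shows "(\<lambda>n. norm (S j (x n) - x n)) \<longlonglongrightarrow> 0"
proof (rule Lim_null_comparison)
  let ?z = "\<lambda>n. z n (i0 n)"
  \<comment> \<open>\<open>z_diff\<close> concerns a fixed index while \<open>i0 n\<close> varies
    with \<open>n\<close>; the finite sum dominates whichever residual is selected.\<close>
  have "norm (S j (x n) - x n) \<le> norm (S j (?z n) - x n) + (\<Sum>i\<in>{1..N}. norm (z n i - x n))" for n
  proof -
    have "norm (S j (x n) - S j (?z n)) \<le> norm (?z n - x n)"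
      using S[OF j] x_in z_in[OF i0_in] by (simp add: nonexpansive_on_def norm_minus_commute)
    also have "\<dots> \<le> (\<Sum>i\<in>{1..N}. norm (z n i - x n))"
      using i0_in by (intro member_le_sum) auto
    finally show ?thesis
      using norm_triangle_ineq[of "S j (x n) - S j (?z n)" "S j (?z n) - x n"] by simp
  qed
  then show "\<forall>\<^sub>F n in sequentially. norm (norm (S j (x n) - x n))
      \<le> norm (S j (?z n) - x n) + (\<Sum>i\<in>{1..N}. norm (z n i - x n))"
    by simp
  show "(\<lambda>n. norm (S j (?z n) - x n) + (\<Sum>i\<in>{1..N}. norm (z n i - x n))) \<longlonglongrightarrow> 0"
    using tendsto_add[OF S_z_diff[OF j] tendsto_sum[of "{1..N}" "\<lambda>i n. norm (z n i - x n)" "\<lambda>_. 0"]]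
      z_diff by simp
qed

section \<open>Identification of cluster points and strong convergence\<close>

lemma weak_cluster_point_in_F:
  assumes r: "strict_mono r" and p: "weakly_converges (\<lambda>k. x (r k)) p"
  shows "p \<in> F"
proof -
  have pC: "p \<in> C"
    by (rule weakly_converges_closed_convex[OF C x_in p])
  obtain w where w: "w \<in> F"
    using F_nonempty by blast
  \<comment> \<open>Used with \<open>v = 0\<close> for the equilibrium part and with
    \<open>v = p\<close> for demiclosedness.\<close>
  have bound: "norm (x n - v) \<le> norm (w - x0) + norm (w - v)" for n v
    using norm_triangle_ineq[of "x n - w" "w - v"] x_bounded[OF w, of n] by simp
  have "p \<in> EP C (f i)" if i: "i \<in> {1..N}" for i
    using LIMSEQ_subseq_LIMSEQ[OF y_diff[OF i] r] bound[of _ 0] p pC C rho(1)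
    by (intro weak_limit_of_prox_in_EP[where X = "\<lambda>k. x (r k)" and Y = "\<lambda>k. y (r k) i"]
        bifunction[OF i] A3[OF i] A4[OF i] x_in) (auto simp: o_def intro: y[OF i])
  moreover have "S j p = p" if j: "j \<in> {1..M}" for j
    using LIMSEQ_subseq_LIMSEQ[OF S_x_diff[OF j] r] bound[of _ p] p pC
    by (intro nonexpansive_demiclosed[OF S[OF j], where X = "\<lambda>k. x (r k)"] x_in)
      (auto simp: o_def)
  ultimately show ?thesis
    using pC by (auto simp: F_def fixed_points_def)
qed

theorem iterates_tendsto_metric_proj: "x \<longlonglongrightarrow> metric_proj F x0"
proof -
  obtain w where w: "w \<in> F"
    using F_nonempty by blast
  have "norm (x n) \<le> norm (w - x0) + norm w" for n
    using norm_triangle_ineq[of "x n - w" w] x_bounded[OF w, of n] by simp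
  then obtain r p where r: "strict_mono r" and p: "weakly_converges (\<lambda>k. x (r k)) p"
    using bounded_seq_weakly_convergent_subseq[of x] by blast
  have pF: "p \<in> F"
    by (rule weak_cluster_point_in_F[OF r p])
  \<comment> \<open>Membership of \<open>p\<close> in the halfspaces \<open>Q\<^sub>n\<close> upgrades weak to strong convergence.\<close>
  have "(\<lambda>k. (norm (x (r k) - p))\<^sup>2) \<longlonglongrightarrow> 0"
  proof (rule Lim_null_comparison)
    \<comment> \<open>Split one factor p - x_n as (p - x0) + (x0 - x_n) and drop the nonpositive
      product. What remains is affine in x_n, hence accessible to weak convergence.\<close>
    have "(norm (x n - p))\<^sup>2 \<le> p \<bullet> (p - x0) - x n \<bullet> (p - x0)" for n
      using F_obtuse[OF pF, of n]
      by (simp add: power2_norm_eq_inner inner_diff_left inner_diff_right inner_commute)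
    then show "\<forall>\<^sub>F k in sequentially. norm ((norm (x (r k) - p))\<^sup>2) \<le> p \<bullet> (p - x0) - x (r k) \<bullet> (p - x0)"
      by simp
    have "(\<lambda>k. p \<bullet> (p - x0) - x (r k) \<bullet> (p - x0)) \<longlonglongrightarrow> p \<bullet> (p - x0) - p \<bullet> (p - x0)"
      using p by (intro tendsto_diff tendsto_const) (simp add: weakly_converges_def)
    then show "(\<lambda>k. p \<bullet> (p - x0) - x (r k) \<bullet> (p - x0)) \<longlonglongrightarrow> 0"
      by simp
  qed
  then have xr: "(\<lambda>k. x (r k)) \<longlonglongrightarrow> p"
    by (simp add: LIM_zero_iff tendsto_norm_zero_iff)
  have norm_r: "(\<lambda>k. (norm (x (r k) - x0))\<^sup>2) \<longlonglongrightarrow> (norm (p - x0))\<^sup>2"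
    by (intro tendsto_intros xr)
  have min: "norm (p - x0) \<le> norm (v - x0)" if "v \<in> F" for v
  proof (rule power2_le_imp_le)
    show "(norm (p - x0))\<^sup>2 \<le> (norm (v - x0))\<^sup>2"
    proof (rule LIMSEQ_le_const2[OF norm_r])
      have "(norm (x (r k) - x0))\<^sup>2 \<le> (norm (v - x0))\<^sup>2" for k
        using F_pythagoras[OF that, of "r k"] zero_le_power2[of "norm (v - x (r k))"] by linarith
      then show "\<exists>N. \<forall>k\<ge>N. (norm (x (r k) - x0))\<^sup>2 \<le> (norm (v - x0))\<^sup>2"
        by blast
    qed
  qed simp
  \<comment> \<open>The cluster point itself witnesses that \<open>F\<close> has a point nearest to
    \<open>x0\<close>, which gives the choice in \<open>metric_proj\<close> its meaning.\<close>
  then have "is_arg_min (\<lambda>v. norm (x0 - v)) (\<lambda>v. v \<in> F) p"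
    using pF by (simp add: is_arg_min_linorder norm_minus_commute)
  from metric_proj_is_arg_min[OF this] have
    q: "metric_proj F x0 \<in> F" "norm (metric_proj F x0 - x0) \<le> norm (p - x0)"
    using pF by (auto simp: is_arg_min_linorder norm_minus_commute)
  let ?q = "metric_proj F x0" and ?g = "\<lambda>n. (norm (x n - x0))\<^sup>2"
  obtain l where l: "?g \<longlonglongrightarrow> l"
    using norm_x_convergent unfolding convergent_def by blast
  have "l = (norm (p - x0))\<^sup>2"
    using LIMSEQ_unique[OF LIMSEQ_subseq_LIMSEQ[OF l r]] norm_r by (simp add: o_def)
  with l have "(\<lambda>n. (norm (p - x0))\<^sup>2 - ?g n) \<longlonglongrightarrow> 0"
    using tendsto_diff[OF tendsto_const[of l] l] by simp
  then have "(\<lambda>n. (norm (x n - ?q))\<^sup>2) \<longlonglongrightarrow> 0"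
  proof (rule Lim_null_comparison[rotated])
    \<comment> \<open>\<open>F_pythagoras\<close> at \<open>?q\<close>, which is no farther from
      \<open>x0\<close> than \<open>p\<close> is.\<close>
    have "(norm (x n - ?q))\<^sup>2 \<le> (norm (p - x0))\<^sup>2 - ?g n" for n
      using F_pythagoras[OF q(1), of n] power_mono[OF q(2) norm_ge_zero, of 2]
      unfolding norm_minus_commute[of "x n" ?q] by linarith
    then show "\<forall>\<^sub>F n in sequentially. norm ((norm (x n - ?q))\<^sup>2) \<le> (norm (p - x0))\<^sup>2 - ?g n"
      by simp
  qed
  then show ?thesis
    by (simp add: LIM_zero_iff tendsto_norm_zero_iff)
qed

end

theorem theorem1:
  fixes C :: "'a::{real_inner, complete_space} set"
    and N M :: nat
    and f :: "nat \<Rightarrow> 'a \<Rightarrow> 'a \<Rightarrow> ereal"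
    and S :: "nat \<Rightarrow> 'a \<Rightarrow> 'a"
    and c1 c2 \<rho> :: real
    and \<alpha> :: "nat \<Rightarrow> real"
    and x0 :: 'a
    and x :: "nat \<Rightarrow> 'a"
    and F :: "'a set"
  assumes C: "C \<noteq> {}" "closed C" "convex C"
    and NM: "N \<ge> 1" "M \<ge> 1"
    and bifunction: "\<And>i. i \<in> {1..N} \<Longrightarrow> bifunction_on C (f i)"
    and A1: "\<And>i. i \<in> {1..N} \<Longrightarrow> pseudomonotone_on C (f i)"
    and c_pos: "c1 > 0" "c2 > 0"
    and A2: "\<And>i. i \<in> {1..N} \<Longrightarrow> lipschitz_type_on c1 c2 C (f i)"
    and A3: "\<And>i. i \<in> {1..N} \<Longrightarrow> weakly_continuous_on C (f i)"
    and A4: "\<And>i v. i \<in> {1..N} \<Longrightarrow> v \<in> C \<Longrightarrow>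
               ereal_convex_on C (f i v) \<and> subdifferentiable_on C (f i v)"
    and S: "\<And>j. j \<in> {1..M} \<Longrightarrow> nonexpansive_on C (S j)"
    and F_def: "F = (\<Inter>i\<in>{1..N}. EP C (f i)) \<inter> (\<Inter>j\<in>{1..M}. fixed_points C (S j))"
    and F_nonempty: "F \<noteq> {}"
    and x0: "x0 \<in> C"
    and rho: "0 < \<rho>" "\<rho> < min (1 / (2 * c1)) (1 / (2 * c2))"
    and alpha: "\<And>n. 0 < \<alpha> n \<and> \<alpha> n < 1"
    and alpha_limsup: "limsup (\<lambda>n. ereal (\<alpha> n)) < 1"
    and iterates: "mann_extragradient_iterates C N f M S \<rho> \<alpha> x0 x"
    and no_stop: "\<And>n. x (Suc n) \<noteq> x n"
  shows "x \<longlonglongrightarrow> metric_proj F x0"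
proof -
  from iterates have x_0: "x 0 = x0"
    and steps: "\<forall>n. mann_extragradient_step C N f M S \<rho> (\<alpha> n) x0 (x n) (x (Suc n))"
    by (auto simp: mann_extragradient_iterates_def)
  \<comment> \<open>Skolemization over \<open>n\<close>: \<open>choice_iff\<close> turns the
    separate existential choices of the steps into sequences.\<close>
  from steps obtain y z i0 u j0 where
    "\<forall>n. (\<forall>i\<in>{1..N}. is_arg_min (prox_objective \<rho> (f i (x n)) (x n)) (\<lambda>v. v \<in> C) (y n i)) \<and>
      (\<forall>i\<in>{1..N}. is_arg_min (prox_objective \<rho> (f i (y n i)) (x n)) (\<lambda>v. v \<in> C) (z n i)) \<and>
      is_arg_max (\<lambda>i. norm (z n i - x n)) (\<lambda>i. i \<in> {1..N}) (i0 n) \<and>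
      (\<forall>j\<in>{1..M}. u n j = \<alpha> n *\<^sub>R x n + (1 - \<alpha> n) *\<^sub>R S j (z n (i0 n))) \<and>
      is_arg_max (\<lambda>j. norm (u n j - x n)) (\<lambda>j. j \<in> {1..M}) (j0 n) \<and>
      x (Suc n) = metric_proj (mann_outer_set C x0 (x n) (u n (j0 n))) x0"
    unfolding mann_extragradient_step_def mann_outer_set_def choice_iff by blast
  then interpret mann_extragradient_run C N M f S c1 c2 \<rho> \<alpha> x0 x F y z u i0 j0
    using assms x_0 by unfold_locales auto
  show ?thesis
    by (rule iterates_tendsto_metric_proj)
qed

end
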